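(* Let $\lambda, n \in \mathbb{N}$. Then $$\widetilde{\chi}(\lambda K_n) = \begin{cases} 3 & \text{if } \lambda \text{ is odd and } n \equiv 3 \pmod 4,\\ 2 & \text{otherwise.}\end{cases}$$
   Context: $\mathbb{N}$ denotes the positive integers. A multigraph $G=(V,E)$ is finite and without loops; parallel edges are allowed. For $x\in V$, $E(x)$ denotes the set of edges of $G$ incident to $x$ (parallel edges counted separately). $\lambda K_n$ is the complete multigraph on $n$ vertices in which every pair of distinct vertices is joined by exactly $\lambda$ parallel edges. For an integer $m\ge 2$, an $m$-homogeneous edge-coloring of $G$ is a map $c\colon E\to S$, where $S$ is a set of colors with $|S|=m$ ($c$ is not required to be surjective or proper), such that for every $x\in V$, writing $|E(x)|=m q_x+r_x$ with $0\le r_x<m$, exactly $r_x$ of the colors in $S$ are each assigned to exactly $q_x+1$ edges of $E(x)$, and each of the other $m-r_x$ colors is assigned to exactly $q_x$ edges of $E(x)$. (In particular, if $|E(x)|<m$, the edges of $E(x)$ have pairwise different colors.) The homogeneous chromatic index $\widetilde{\chi}(G)$ is the minimum integer $m\ge 2$ such that $G$ admits an $m$-homogeneous edge-coloring. *)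

theory Defs
  imports "HOL-Library.FuncSet"
begin

record ('v, 'e) multigraph =
  verts :: "'v set"
  edges :: "'e set"
  ends :: "'e \<Rightarrow> 'v set"

text \<open>Edges are objects of their own, so that parallel edges are different edges with the same
  set of ends; a two-element set of ends excludes loops.\<close>

locale finite_multigraph =
  fixes G :: "('v, 'e) multigraph"
  assumes finite_verts: "finite (verts G)"
    and finite_edges: "finite (edges G)"
    and ends_verts: "e \<in> edges G \<Longrightarrow> ends G e \<subseteq> verts G"
    and card_ends: "e \<in> edges G \<Longrightarrow> card (ends G e) = 2"

definition incident_edges :: "('v, 'e) multigraph \<Rightarrow> 'v \<Rightarrow> 'e set" where
  "incident_edges G x = {e \<in> edges G. x \<in> ends G e}"

locale complete_multigraph = finite_multigraph G
  for lam n :: nat and G :: "('v, 'e) multigraph" +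
  assumes card_verts: "card (verts G) = n"
    and card_joining_edges:
      "\<lbrakk>x \<in> verts G; y \<in> verts G; x \<noteq> y\<rbrakk> \<Longrightarrow> card {e \<in> edges G. ends G e = {x, y}} = lam"

text \<open>Below, \<open>card (incident_edges G x) div m\<close> and \<open>card (incident_edges G x) mod m\<close> are the
  quotient \<open>q\<^sub>x\<close> and the remainder \<open>r\<^sub>x\<close>, and \<open>R\<close> is the set of the \<open>r\<^sub>x\<close> colors that are
  used once more than the others at \<open>x\<close>.\<close>

definition homogeneous_edge_coloring ::
    "nat \<Rightarrow> ('v, 'e) multigraph \<Rightarrow> 'c set \<Rightarrow> ('e \<Rightarrow> 'c) \<Rightarrow> bool" where
  "homogeneous_edge_coloring m G S c \<longleftrightarrow>
     2 \<le> m \<and> finite S \<and> card S = m \<and> c \<in> edges G \<rightarrow> S \<and>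
     (\<forall>x \<in> verts G. \<exists>R \<subseteq> S.
        card R = card (incident_edges G x) mod m \<and>
        (\<forall>s \<in> R. card {e \<in> incident_edges G x. c e = s} = card (incident_edges G x) div m + 1) \<and>
        (\<forall>s \<in> S - R. card {e \<in> incident_edges G x. c e = s} = card (incident_edges G x) div m))"

text \<open>Colors are taken to be natural numbers here; by the lemma
  \<open>homogeneous_edge_coloring_nat\<close> this is no restriction. The minimum is attained for every
  finite multigraph, by the lemma \<open>ex_homogeneous_edge_coloring\<close>.\<close>

definition homogeneous_chromatic_index :: "('v, 'e) multigraph \<Rightarrow> nat" where
  "homogeneous_chromatic_index G =
     (LEAST m. 2 \<le> m \<and> (\<exists>(S :: nat set) c. homogeneous_edge_coloring m G S c))"

lemma homogeneous_edge_coloring_nat: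
  fixes S :: "'c set"
  assumes "homogeneous_edge_coloring m G S c"
  shows "\<exists>(S' :: nat set) c'. homogeneous_edge_coloring m G S' c'"
proof -
  from assms have S: "finite S" "card S = m" "2 \<le> m" and c: "c \<in> edges G \<rightarrow> S"
    by (auto simp: homogeneous_edge_coloring_def)
  obtain f :: "'c \<Rightarrow> nat" where f: "bij_betw f S {0..<card S}"
    using ex_bij_betw_finite_nat[OF S(1)] by blast
  have inj: "inj_on f S" and im: "f ` S = {0..<m}"
    using f S by (auto simp: bij_betw_def)
  have col: "{e \<in> incident_edges G x. f (c e) = f s} = {e \<in> incident_edges G x. c e = s}"
    if "s \<in> S" for x s
    using that c inj by (auto simp: incident_edges_def inj_on_def)
  have "homogeneous_edge_coloring m G {0..<m} (f \<circ> c)"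
    unfolding homogeneous_edge_coloring_def
  proof (intro conjI ballI)
    show "f \<circ> c \<in> edges G \<rightarrow> {0..<m}" unfolding im[symmetric] using c by auto
    fix x assume "x \<in> verts G"
    then obtain R where R: "R \<subseteq> S" "card R = card (incident_edges G x) mod m"
      "\<forall>s\<in>R. card {e \<in> incident_edges G x. c e = s} = card (incident_edges G x) div m + 1"
      "\<forall>s\<in>S-R. card {e \<in> incident_edges G x. c e = s} = card (incident_edges G x) div m"
      using assms unfolding homogeneous_edge_coloring_def by meson
    have diff: "{0..<m} - f ` R = f ` (S - R)"
      using inj im R(1) by (metis inj_on_image_set_diff Diff_subset order_refl)
    have RS: "s \<in> S" if "s \<in> R" for s using that R(1) by auto
    show "\<exists>R'\<subseteq>{0..<m}. card R' = card (incident_edges G x) mod m \<and>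
      (\<forall>s\<in>R'. card {e \<in> incident_edges G x. (f \<circ> c) e = s} = card (incident_edges G x) div m + 1) \<and>
      (\<forall>s\<in>{0..<m}-R'. card {e \<in> incident_edges G x. (f \<circ> c) e = s} = card (incident_edges G x) div m)"
    proof (intro exI[of _ "f ` R"] conjI)
      show "f ` R \<subseteq> {0..<m}" using R(1) im by auto
      show "card (f ` R) = card (incident_edges G x) mod m"
        using R(1,2) inj by (metis card_image inj_on_subset)
    qed (use R RS in \<open>auto simp: diff col\<close>)
  qed (use S in auto)
  then show ?thesis by blast
qed

lemma (in finite_multigraph) ex_homogeneous_edge_coloring:
  "\<exists>m \<ge> 2. \<exists>(S :: nat set) c. homogeneous_edge_coloring m G S c"
proof -
  define m where "m = card (edges G) + 2"
  obtain f :: "'e \<Rightarrow> nat" where f: "bij_betw f (edges G) {0..<card (edges G)}"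
    using ex_bij_betw_finite_nat[OF finite_edges] by blast
  have inj: "inj_on f (edges G)" and im: "f ` edges G = {0..<card (edges G)}"
    using f by (auto simp: bij_betw_def)
  have im': "f ` edges G \<subseteq> {0..<m}" unfolding im by (auto simp: m_def)
  have "homogeneous_edge_coloring m G {0..<m} f"
    unfolding homogeneous_edge_coloring_def
  proof (intro conjI ballI)
    show "f \<in> edges G \<rightarrow> {0..<m}" using im' by auto
    fix x
    let ?I = "incident_edges G x"
    have I: "?I \<subseteq> edges G" by (auto simp: incident_edges_def)
    then have "card ?I < m"
      using card_mono[OF finite_edges I] by (simp add: m_def)
    then have dm: "card ?I div m = 0" "card ?I mod m = card ?I" by auto
    have one: "{e \<in> ?I. f e = f d} = {d}" if "d \<in> ?I" for d
      using that I inj by (auto simp: inj_on_def)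
    have none: "{e \<in> ?I. f e = s} = {}" if "s \<notin> f ` ?I" for s using that by auto
    show "\<exists>R\<subseteq>{0..<m}. card R = card ?I mod m \<and>
      (\<forall>s\<in>R. card {e \<in> ?I. f e = s} = card ?I div m + 1) \<and>
      (\<forall>s\<in>{0..<m}-R. card {e \<in> ?I. f e = s} = card ?I div m)"
    proof (intro exI[of _ "f ` ?I"] conjI)
      show "f ` ?I \<subseteq> {0..<m}" using I im' by blast
      show "card (f ` ?I) = card ?I mod m"
        unfolding dm using inj I by (metis card_image inj_on_subset)
      show "\<forall>s\<in>f ` ?I. card {e \<in> ?I. f e = s} = card ?I div m + 1"
        by (auto simp: dm one)
      show "\<forall>s\<in>{0..<m} - f ` ?I. card {e \<in> ?I. f e = s} = card ?I div m"
        by (simp add: dm none)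
    qed
  qed (auto simp: m_def)
  moreover have "2 \<le> m" by (simp add: m_def)
  ultimately show ?thesis by blast
qed

lemma ex_complete_multigraph:
  "\<exists>G :: (nat, nat set \<times> nat) multigraph. complete_multigraph lam n G"
proof -
  let ?E = "{e. e \<subseteq> {..<n} \<and> card e = 2} \<times> {..<lam}"
  let ?G = "\<lparr>verts = {..<n}, edges = ?E, ends = fst\<rparr> :: (nat, nat set \<times> nat) multigraph"
  have fin: "finite ?E" by (auto intro: finite_subset[of _ "Pow {..<n}"])
  have "card {e \<in> ?E. fst e = {x, y}} = lam" if "x < n" "y < n" "x \<noteq> y" for x y
  proof -
    have "{e \<in> ?E. fst e = {x, y}} = {{x, y}} \<times> {..<lam}" using that by auto
    then show ?thesis by (simp add: card_cartesian_product)
  qed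
  then have "complete_multigraph lam n ?G"
    using fin by unfold_locales auto
  then show ?thesis by blast
qed

end

theory Submission
  imports Defs
begin

text \<open>A coloring is homogeneous as soon as the numbers of edges of any two colors at a vertex differ
  by at most one. For \<open>\<lambda> mod m \<in> {0, 1, m - 1}\<close> such a coloring of \<open>\<lambda>K\<^sub>n\<close> with \<open>m\<close> colors comes from a
  balanced coloring \<open>p\<close> of \<open>K\<^sub>n\<close>: give the \<open>l\<close>-th edge joining \<open>i\<close> and \<open>j\<close> the color
  \<open>(l + p i j) mod m\<close>. Balanced colorings of \<open>K\<^sub>n\<close> come from Hankel matrices \<open>g (i + j)\<close> with \<open>g\<close>
  periodic: if every row contains all colors equally often, then \<open>p i j = g (i + j)\<close> is balanced, and
  if the diagonal does so too, then a new vertex can be added by giving the edge from \<open>i\<close> to it the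
  unused diagonal color \<open>p i i\<close>, which makes the coloring exactly balanced; one more vertex can then be
  joined by edges with evenly distributed colors. For two colors take
  \<open>g x = x mod 2\<close> when \<open>n\<close> is even and \<open>g x = \<lfloor>x/2\<rfloor> mod 2\<close> when \<open>n mod 4 = 1\<close>; for three colors
  take \<open>g x = x mod 3\<close>. If \<open>\<lambda>\<close> is odd and \<open>n mod 4 = 3\<close>, a homogeneous coloring with two colors would make
  each color class a regular graph of odd degree on an odd number of vertices.\<close>

section \<open>Homogeneity as near equality of the color degrees\<close>

text \<open>At each vertex the least color degree serves as the quotient and the colors above it
  form \<open>R\<close>. A color attaining the minimum lies outside \<open>R\<close>, so
  \<open>card R < m\<close> and uniqueness of division with remainder applies.\<close>

lemma homogeneous_edge_coloringI:
  fixes G :: "('v, 'e) multigraph" and c :: "'e \<Rightarrow> 'c"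
  assumes "finite (edges G)" "2 \<le> m" "finite S" "card S = m" "c \<in> edges G \<rightarrow> S"
    and near: "\<And>x s t. \<lbrakk>x \<in> verts G; s \<in> S; t \<in> S\<rbrakk> \<Longrightarrow>
      card {e \<in> incident_edges G x. c e = s} \<le> card {e \<in> incident_edges G x. c e = t} + 1"
  shows "homogeneous_edge_coloring m G S c"
  unfolding homogeneous_edge_coloring_def
proof (intro conjI ballI)
  fix x assume x: "x \<in> verts G"
  define d where "d = (\<lambda>s. card {e \<in> incident_edges G x. c e = s})"
  have fin: "finite (incident_edges G x)"
    using assms(1) by (auto simp: incident_edges_def)
  have "S \<noteq> {}" using assms by auto
  define q where "q = Min (d ` S)"
  have q: "q \<in> d ` S" "\<And>s. s \<in> S \<Longrightarrow> q \<le> d s"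
    using \<open>finite S\<close> \<open>S \<noteq> {}\<close> by (auto simp: q_def)
  then obtain t where t: "t \<in> S" "d t = q" by auto
  define R where "R = {s \<in> S. d s \<noteq> q}"
  have dR: "d s = q + of_bool (s \<in> R)" if "s \<in> S" for s
    using near[OF x that t(1)] q(2)[OF that] that t(2) by (auto simp: R_def d_def)
  have "R \<subset> S" using t by (auto simp: R_def)
  then have "card R < m" using \<open>finite S\<close> \<open>card S = m\<close> psubset_card_mono by blast
  have "card (incident_edges G x) = (\<Sum>s\<in>S. d s)"
  proof -
    have "incident_edges G x = (\<Union>s\<in>S. {e \<in> incident_edges G x. c e = s})"
      using assms(5) by (auto simp: incident_edges_def)
    then show ?thesis
      unfolding d_def using fin \<open>finite S\<close>
      by (subst card_UN_disjoint[symmetric]) auto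
  qed
  also have "\<dots> = (\<Sum>s\<in>S. q + of_bool (s \<in> R))" by (rule sum.cong) (auto simp: dR)
  also have "\<dots> = m * q + card R"
    using \<open>finite S\<close> \<open>card S = m\<close> \<open>R \<subset> S\<close>
    by (simp add: sum.distrib Int_absorb1 psubset_imp_subset)
  finally have "card (incident_edges G x) div m = q" "card (incident_edges G x) mod m = card R"
    using \<open>card R < m\<close> by auto
  then show "\<exists>R\<subseteq>S. card R = card (incident_edges G x) mod m \<and>
      (\<forall>s\<in>R. card {e \<in> incident_edges G x. c e = s} = card (incident_edges G x) div m + 1) \<and>
      (\<forall>s\<in>S - R. card {e \<in> incident_edges G x. c e = s} = card (incident_edges G x) div m)"
    using dR \<open>R \<subset> S\<close> by (intro exI[of _ R]) (auto simp: d_def)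
qed (use assms in auto)

lemma (in complete_multigraph) card_incident_edges_filter:
  assumes x: "x \<in> verts G"
  shows "card {e \<in> incident_edges G x. P e} =
    (\<Sum>y\<in>verts G - {x}. card {e \<in> edges G. ends G e = {x, y} \<and> P e})"
proof -
  have "{e \<in> incident_edges G x. P e} =
      (\<Union>y\<in>verts G - {x}. {e \<in> edges G. ends G e = {x, y} \<and> P e})"
  proof (intro equalityI subsetI)
    fix e assume "e \<in> {e \<in> incident_edges G x. P e}"
    then have e: "e \<in> edges G" "x \<in> ends G e" "P e" by (auto simp: incident_edges_def)
    obtain y z where "ends G e = {y, z}" "y \<noteq> z"
      using card_ends[OF e(1)] by (auto simp: card_2_iff)
    with e(2) obtain y where "ends G e = {x, y}" "x \<noteq> y"
      by (metis insert_commute insertE singletonD)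
    then show "e \<in> (\<Union>y\<in>verts G - {x}. {e \<in> edges G. ends G e = {x, y} \<and> P e})"
      using e ends_verts[OF e(1)] by auto
  qed (auto simp: incident_edges_def)
  then show ?thesis
    using finite_verts finite_edges
    by (simp only:) (subst card_UN_disjoint, auto simp: doubleton_eq_iff)
qed

lemma (in complete_multigraph) card_incident_edges:
  assumes "x \<in> verts G"
  shows "card (incident_edges G x) = lam * (n - 1)"
proof -
  have "card (incident_edges G x) = (\<Sum>y\<in>verts G - {x}. card {e \<in> edges G. ends G e = {x, y}})"
    using card_incident_edges_filter[OF assms, of "\<lambda>_. True"] by simp
  also have "\<dots> = (\<Sum>y\<in>verts G - {x}. lam)"
    by (rule sum.cong) (use assms card_joining_edges in auto)
  finally have "card (incident_edges G x) = (\<Sum>y\<in>verts G - {x}. lam)" .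
  then show ?thesis using assms finite_verts by (simp add: card_verts)
qed

section \<open>From balanced colorings of pairs to homogeneous edge-colorings\<close>

lemma sum_periodic:
  fixes f :: "nat \<Rightarrow> nat"
  assumes "\<And>x. f (x + m) = f x"
  shows "(\<Sum>l<m * a + b. f l) = a * (\<Sum>l<m. f l) + (\<Sum>l<b. f l)"
proof (induction a)
  case (Suc a)
  have *: "(\<Sum>l<m + N. f l) = (\<Sum>l<m. f l) + (\<Sum>l<N. f l)" for N
    by (induction N) (use assms in \<open>auto simp: add.commute\<close>)
  show ?case using Suc *[of "m * a + b"] by (simp add: add.assoc)
qed simp

lemma sum_periodic_shift:
  fixes f :: "nat \<Rightarrow> nat"
  assumes "\<And>x. f (x + m) = f x"
  shows "(\<Sum>l<m. f (i + l)) = (\<Sum>l<m. f l)"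
proof (induction i)
  case (Suc i)
  have "f i + (\<Sum>l<m. f (Suc i + l)) = (\<Sum>l<Suc m. f (i + l))"
    by (subst sum.lessThan_Suc_shift) simp
  then show ?case using Suc assms[of i] by simp
qed simp

text \<open>Adding \<open>p\<close> permutes the residues modulo \<open>m\<close>.\<close>

lemma sum_of_bool_mod_shift:
  fixes m p s :: nat
  assumes "p < m" "s < m"
  shows "(\<Sum>l<m. of_bool ((l + p) mod m = s)) = (1::nat)"
proof -
  have "(l + p) mod m = (if l + p < m then l + p else l + p - m)" if "l < m" for l
    using that assms(1) by (simp add: le_mod_geq)
  then have "{l. l < m \<and> (l + p) mod m = s} = {if p \<le> s then s - p else s + m - p}"
    using assms by (auto split: if_splits)
  then have "card ({..<m} \<inter> {l. (l + p) mod m = s}) = 1"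
    by (simp add: Int_def)
  then show ?thesis by simp
qed

text \<open>The term \<open>j = i\<close> is left out because \<open>p i i\<close> colors no edge;
  this free value is what a new vertex can use later.\<close>

definition color_degree :: "(nat \<Rightarrow> nat \<Rightarrow> nat) \<Rightarrow> nat \<Rightarrow> nat \<Rightarrow> nat \<Rightarrow> nat" where
  "color_degree p n i s = (\<Sum>j\<in>{..<n} - {i}. of_bool (p i j = s))"

definition pair_coloring :: "nat \<Rightarrow> (nat \<Rightarrow> nat \<Rightarrow> nat) \<Rightarrow> bool" where
  "pair_coloring m p \<longleftrightarrow> (\<forall>i j. p i j = p j i \<and> p i j < m)"

definition balanced :: "nat \<Rightarrow> nat \<Rightarrow> (nat \<Rightarrow> nat \<Rightarrow> nat) \<Rightarrow> bool" where
  "balanced m n p \<longleftrightarrow> pair_coloring m p \<and>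
     (\<forall>i<n. \<forall>s<m. \<forall>t<m. color_degree p n i s \<le> color_degree p n i t + 1)"

definition exactly_balanced :: "nat \<Rightarrow> nat \<Rightarrow> nat \<Rightarrow> (nat \<Rightarrow> nat \<Rightarrow> nat) \<Rightarrow> bool" where
  "exactly_balanced k m n p \<longleftrightarrow> pair_coloring m p \<and> (\<forall>i<n. \<forall>s<m. color_degree p n i s = k)"

lemma balanced_if_exactly_balanced: "exactly_balanced k m n p \<Longrightarrow> balanced m n p"
  by (simp add: balanced_def exactly_balanced_def)

text \<open>Full blocks of \<open>m\<close> parallel edges use all colors equally, so only the
  \<open>lam mod m\<close> leftover edges of each pair matter. One leftover edge reproduces
  \<open>p\<close>; with \<open>m - 1\<close> of them each pair misses a single color, and the
  missing colors form a shifted copy of \<open>p\<close>.\<close>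

lemma (in complete_multigraph) ex_homogeneous_edge_coloring_if_balanced:
  assumes m: "2 \<le> m" and "pair_coloring m p"
    and lam: "lam mod m = 0 \<or> lam mod m \<in> {1, m - 1} \<and> balanced m n p"
  shows "\<exists>c. homogeneous_edge_coloring m G {..<m} c"
proof -
  have sym: "p i j = p j i" and lt: "p i j < m" for i j
    using assms(2) by (auto simp: pair_coloring_def)
  define a b where "a = lam div m" and "b = lam mod m"
  have ab: "lam = m * a + b" by (simp add: a_def b_def)
  obtain h where h: "bij_betw h (verts G) {..<n}"
    using ex_bij_betw_finite_nat[OF finite_verts] card_verts by (auto simp: atLeast0LessThan)
  have "\<exists>f. \<forall>A. bij_betw (f A) {e \<in> edges G. ends G e = A}
      {..<card {e \<in> edges G. ends G e = A}}"
    by (intro choice allI)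
      (use ex_bij_betw_finite_nat[of "{e \<in> edges G. ends G e = A}" for A] finite_edges in
        \<open>auto simp: atLeast0LessThan\<close>)
  then obtain f where f:
    "bij_betw (f A) {e \<in> edges G. ends G e = A} {..<card {e \<in> edges G. ends G e = A}}" for A
    by blast
  \<comment> \<open>\<open>Min\<close> and \<open>Max\<close> recover the numbers of the two ends
    from the unordered set; their order is immaterial since \<open>p\<close> is symmetric.\<close>
  define c where "c e = (f (ends G e) e + p (Min (h ` ends G e)) (Max (h ` ends G e))) mod m" for e
  define w where "w i j s = (\<Sum>l<b. of_bool ((l + p i j) mod m = s) :: nat)" for i j s
  have joining: "card {e \<in> edges G. ends G e = {x, y} \<and> c e = s} = a + w (h x) (h y) s"
    if "x \<in> verts G" "y \<in> verts G" "x \<noteq> y" "s < m" for x y s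
  proof -
    let ?E = "{e \<in> edges G. ends G e = {x, y}}"
    let ?q = "p (h x) (h y)"
    have c: "c e = (f {x, y} e + ?q) mod m" if "e \<in> ?E" for e
      using that sym[of "h x" "h y"] by (auto simp: c_def min_def max_def)
    have bij: "bij_betw (f {x, y}) ?E {..<lam}"
      using f[of "{x, y}"] card_joining_edges[OF that(1-3)] by simp
    have "card {e \<in> edges G. ends G e = {x, y} \<and> c e = s}
        = card {e \<in> ?E. (f {x, y} e + ?q) mod m = s}"
      by (rule arg_cong[of _ _ card]) (use c in auto)
    also have "\<dots> = (\<Sum>e\<in>?E. of_bool ((f {x, y} e + ?q) mod m = s))"
      using finite_edges by (simp add: Int_def conj_ac)
    also have "\<dots> = (\<Sum>l<m * a + b. of_bool ((l + ?q) mod m = s))"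
      unfolding ab[symmetric] by (rule sum.reindex_bij_betw[OF bij])
    also have "\<dots> = a * (\<Sum>l<m. of_bool ((l + ?q) mod m = s)) + w (h x) (h y) s"
      unfolding w_def by (rule sum_periodic) (metis add.assoc add.commute mod_add_self2)
    also have "\<dots> = a + w (h x) (h y) s"
      using sum_of_bool_mod_shift[OF lt \<open>s < m\<close>] by simp
    finally show ?thesis .
  qed
  define W where "W i s = (\<Sum>j\<in>{..<n} - {i}. w i j s)" for i s
  have deg: "card {e \<in> incident_edges G x. c e = s} = (n - 1) * a + W (h x) s"
    if "x \<in> verts G" "s < m" for x s
  proof -
    have bij: "bij_betw h (verts G - {x}) ({..<n} - {h x})"
      by (rule bij_betw_DiffI[OF h]) (use that(1) bij_betwE[OF h] in auto)
    have "card {e \<in> incident_edges G x. c e = s} = (\<Sum>y\<in>verts G - {x}. a + w (h x) (h y) s)"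
      unfolding card_incident_edges_filter[OF that(1)]
      by (rule sum.cong) (use that joining in auto)
    also have "\<dots> = (n - 1) * a + W (h x) s"
      using sum.reindex_bij_betw[OF bij, of "\<lambda>j. w (h x) j s"] that(1) finite_verts
      by (simp add: sum.distrib W_def card_verts)
    finally show ?thesis .
  qed
  have W: "W i s \<le> W i t + 1" if "i < n" "s < m" "t < m" for i s t
  proof -
    have p': "color_degree p n i s' \<le> color_degree p n i t' + 1"
      if "b \<noteq> 0" "s' < m" "t' < m" for s' t'
      using lam \<open>i < n\<close> that by (auto simp: balanced_def b_def)
    consider "b = 0" | "b = 1" | "b = m - 1" using lam b_def by auto
    then show ?thesis
    proof cases
      case 1
      then show ?thesis by (simp add: W_def w_def)
    next
      case 2
      then have "W i s' = color_degree p n i s'" for s'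
        using lt by (simp add: W_def w_def color_degree_def)
      then show ?thesis using p' 2 that by simp
    next
      case 3
      \<comment> \<open>The one missing color is that of the absent edge number
        \<open>m - 1\<close>, namely \<open>m - 1 + p i j\<close> modulo \<open>m\<close>.\<close>
      have w: "w i j s' + of_bool (p i j = (s' + 1) mod m) = 1" if "s' < m" for j s'
      proof -
        have "(m - 1 + p i j) mod m = s' \<longleftrightarrow> p i j = (s' + 1) mod m"
          using lt[of i j] that m by (auto simp: mod_if)
        then have "w i j s' + of_bool (p i j = (s' + 1) mod m)
            = (\<Sum>l<Suc (m - 1). of_bool ((l + p i j) mod m = s'))"
          by (simp add: w_def 3)
        then show ?thesis using sum_of_bool_mod_shift[OF lt that] m by simp
      qed
      have W: "W i s' + color_degree p n i ((s' + 1) mod m) = card ({..<n} - {i})"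
        if "s' < m" for s'
        unfolding W_def color_degree_def sum.distrib[symmetric] w[OF that] by simp
      \<comment> \<open>Passing to complements reverses the inequality, so \<open>s\<close> and
        \<open>t\<close> change roles.\<close>
      have "color_degree p n i ((t + 1) mod m) \<le> color_degree p n i ((s + 1) mod m) + 1"
        using m 3 by (intro p') auto
      then show ?thesis using W[of s] W[of t] that by linarith
    qed
  qed
  have "homogeneous_edge_coloring m G {..<m} c"
  proof (rule homogeneous_edge_coloringI)
    show "c \<in> edges G \<rightarrow> {..<m}" using m by (auto simp: c_def)
    fix x s t assume "x \<in> verts G" "s \<in> {..<m}" "t \<in> {..<m}"
    moreover from this have "h x < n" using h by (auto simp: bij_betw_def)
    ultimately show "card {e \<in> incident_edges G x. c e = s}
        \<le> card {e \<in> incident_edges G x. c e = t} + 1"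
      using W[of "h x" s t] by (simp add: deg)
  qed (use m finite_edges in auto)
  then show ?thesis by blast
qed

section \<open>Balanced colorings of pairs\<close>

lemma row_sum_eq_color_degree:
  assumes "i < N"
  shows "(\<Sum>j<N. of_bool (p i j = s)) = color_degree p N i s + of_bool (p i i = s)"
  unfolding color_degree_def using assms by (subst sum.remove[of _ i]) auto

lemma color_degree_Suc:
  "i < N \<Longrightarrow> color_degree p (Suc N) i s = color_degree p N i s + of_bool (p i N = s)"
proof -
  assume "i < N"
  moreover have "{..<Suc N} - {i} - {N} = {..<N} - {i}" by auto
  ultimately show ?thesis
    unfolding color_degree_def by (subst sum.remove[of _ N]) auto
qed

lemma color_degree_last: "color_degree p (Suc N) N s = (\<Sum>j<N. of_bool (p N j = s))"
  unfolding color_degree_def by (rule sum.cong) auto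

definition equitable_rows :: "nat \<Rightarrow> nat \<Rightarrow> nat \<Rightarrow> (nat \<Rightarrow> nat \<Rightarrow> nat) \<Rightarrow> bool" where
  "equitable_rows k m N p \<longleftrightarrow> (\<forall>i<N. \<forall>s<m. (\<Sum>j<N. of_bool (p i j = s)) = k)"

text \<open>Dropping the diagonal entry lowers the count of only one color, and by one.\<close>

lemma balanced_if_equitable_rows:
  assumes "pair_coloring m p" "equitable_rows k m N p"
  shows "balanced m N p"
proof -
  have "k \<le> color_degree p N i s + 1 \<and> color_degree p N i s \<le> k" if "i < N" "s < m" for i s
    using assms(2) that row_sum_eq_color_degree[OF that(1), of p s]
    by (cases "p i i = s") (auto simp: equitable_rows_def)
  then have "color_degree p N i s \<le> color_degree p N i t + 1" if "i < N" "s < m" "t < m" for i s t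
    using that le_trans by blast
  then show ?thesis using assms(1) by (simp add: balanced_def)
qed

definition add_vertex :: "nat \<Rightarrow> (nat \<Rightarrow> nat) \<Rightarrow> (nat \<Rightarrow> nat \<Rightarrow> nat) \<Rightarrow> nat \<Rightarrow> nat \<Rightarrow> nat" where
  "add_vertex N d p i j = (if i = N then d j else if j = N then d i else p i j)"

lemma pair_coloring_add_vertex:
  "\<lbrakk>pair_coloring m p; \<And>i. d i < m\<rbrakk> \<Longrightarrow> pair_coloring m (add_vertex N d p)"
  by (auto simp: pair_coloring_def add_vertex_def)

lemma color_degree_add_vertex:
  "i < N \<Longrightarrow> color_degree (add_vertex N d p) (Suc N) i s = color_degree p N i s + of_bool (d i = s)"
  by (simp add: color_degree_Suc) (auto simp: color_degree_def add_vertex_def intro!: sum.cong)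

lemma color_degree_add_vertex_last:
  "color_degree (add_vertex N d p) (Suc N) N s = (\<Sum>j<N. of_bool (d j = s))"
  by (simp add: color_degree_last add_vertex_def)

text \<open>The new edge at \<open>i\<close> restores the color lost with the diagonal entry, and
  the new vertex sees precisely the diagonal.\<close>

lemma exactly_balanced_add_vertex:
  assumes "pair_coloring m p" "equitable_rows k m N p"
    and diag: "\<And>s. s < m \<Longrightarrow> (\<Sum>j<N. of_bool (p j j = s)) = k"
  shows "exactly_balanced k m (Suc N) (add_vertex N (\<lambda>i. p i i) p)"
  unfolding exactly_balanced_def
proof (intro conjI allI impI)
  show "pair_coloring m (add_vertex N (\<lambda>i. p i i) p)"
    using assms(1) by (rule pair_coloring_add_vertex) (use assms(1) in \<open>auto simp: pair_coloring_def\<close>)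
  fix i s assume "i < Suc N" "s < m"
  then consider "i < N" | "i = N" by linarith
  then show "color_degree (add_vertex N (\<lambda>i. p i i) p) (Suc N) i s = k"
  proof cases
    case 1
    then show ?thesis
      using assms(2) \<open>s < m\<close> row_sum_eq_color_degree[OF 1, of p s]
      by (simp add: color_degree_add_vertex equitable_rows_def)
  next
    case 2
    then show ?thesis using diag[OF \<open>s < m\<close>] by (simp add: color_degree_add_vertex_last)
  qed
qed

text \<open>Exact balance tolerates one more edge of any color at the old vertices, so only the new
  vertex constrains \<open>d\<close>.\<close>

lemma balanced_add_vertex:
  assumes p: "exactly_balanced k m N p" and d: "\<And>i. d i < m"
    and last: "\<And>s t. \<lbrakk>s < m; t < m\<rbrakk> \<Longrightarrow>
      (\<Sum>j<N. of_bool (d j = s)) \<le> (\<Sum>j<N. of_bool (d j = t)) + (1::nat)"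
  shows "balanced m (Suc N) (add_vertex N d p)"
  unfolding balanced_def
proof (intro conjI allI impI)
  show "pair_coloring m (add_vertex N d p)"
    using p d by (simp add: exactly_balanced_def pair_coloring_add_vertex)
  fix i s t assume "i < Suc N" and st: "s < m" "t < m"
  then consider "i < N" | "i = N" by linarith
  then show "color_degree (add_vertex N d p) (Suc N) i s
      \<le> color_degree (add_vertex N d p) (Suc N) i t + 1"
  proof cases
    case 1
    then show ?thesis
      using p st by (simp add: color_degree_add_vertex exactly_balanced_def)
  next
    case 2
    then show ?thesis using last[OF st] by (simp add: color_degree_add_vertex_last)
  qed
qed

text \<open>Row \<open>i\<close> is a window of \<open>k\<close> full periods of \<open>g\<close>,
  whose color counts do not depend on where it starts.\<close>

lemma equitable_rows_Hankel:
  assumes g: "\<And>x. g (x + P) = g x"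
    and r: "\<And>s. s < m \<Longrightarrow> (\<Sum>l<P. of_bool (g l = s)) = r"
  shows "equitable_rows (k * r) m (P * k) (\<lambda>i j. g (i + j))"
  unfolding equitable_rows_def
proof (intro allI impI)
  fix i s assume s: "s < m"
  have "(\<Sum>j<P * k + 0. of_bool (g (i + j) = s))
      = k * (\<Sum>j<P. of_bool (g (i + j) = s)) + (\<Sum>j<0. of_bool (g (i + j) = s))"
    by (rule sum_periodic) (simp add: g add.assoc[symmetric])
  moreover have "(\<Sum>j<P. of_bool (g (i + j) = s)) = (\<Sum>j<P. of_bool (g j = s) :: nat)"
    by (rule sum_periodic_shift) (simp add: g)
  ultimately show "(\<Sum>j<P * k. of_bool (g (i + j) = s)) = k * r"
    using r[OF s] by simp
qed

lemma sum_diagonal_Hankel: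
  assumes g: "\<And>x. g (x + P) = g x"
    and r: "(\<Sum>l<P. of_bool (g (l + l) = s)) = r"
  shows "(\<Sum>j<P * k. of_bool (g (j + j) = s)) = k * (r::nat)"
proof -
  have "g (x + P + (x + P)) = g (x + x)" for x
    using g[of "x + x + P"] g[of "x + x"] by (simp add: ac_simps)
  then show ?thesis
    using sum_periodic[of "\<lambda>j. of_bool (g (j + j) = s)" P k 0] r by simp
qed

text \<open>The parity of \<open>i + j\<close> is constant on the diagonal, so it cannot serve for
  odd \<open>n\<close>. The pattern 0, 0, 1, 1 of period four has diagonal values
  \<open>j mod 2\<close>, which alternate.\<close>

lemma ex_balanced_two:
  assumes "n mod 4 \<noteq> 3"
  shows "\<exists>p. balanced 2 n p"
proof (cases "even n")
  case True
  then obtain k where n: "n = 2 * k" by auto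
  let ?g = "\<lambda>x. x mod 2 :: nat"
  have "equitable_rows (k * 1) 2 n (\<lambda>i j. ?g (i + j))"
    unfolding n
  proof (rule equitable_rows_Hankel)
    fix s :: nat assume "s < 2"
    moreover have "{..<2::nat} = {0, 1}" by auto
    ultimately show "(\<Sum>l<2. of_bool (?g l = s)) = (1::nat)"
      by (auto simp: less_2_cases_iff simp del: sum_of_bool_eq)
  qed simp
  moreover have "pair_coloring 2 (\<lambda>i j. ?g (i + j))"
    by (simp add: pair_coloring_def add.commute)
  ultimately show ?thesis using balanced_if_equitable_rows by blast
next
  case False
  define k where "k = n div 4"
  have n: "n = Suc (4 * k)" using False assms unfolding k_def by presburger
  let ?g = "\<lambda>x. x div 2 mod 2 :: nat"
  have g: "?g (x + 4) = ?g x" for x by presburger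
  have lessThan_4: "{..<4::nat} = {0, 1, 2, 3}" by auto
  have "pair_coloring 2 (\<lambda>i j. ?g (i + j))"
    by (simp add: pair_coloring_def add.commute)
  moreover have "equitable_rows (k * 2) 2 (4 * k) (\<lambda>i j. ?g (i + j))"
    using g by (rule equitable_rows_Hankel)
      (auto simp: lessThan_4 less_2_cases_iff simp del: sum_of_bool_eq)
  moreover have "(\<Sum>j<4 * k. of_bool (?g (j + j) = s)) = k * 2" if "s < 2" for s :: nat
    using g by (rule sum_diagonal_Hankel)
      (use that in \<open>auto simp: lessThan_4 less_2_cases_iff simp del: sum_of_bool_eq\<close>)
  ultimately have "balanced 2 n (add_vertex (4 * k) (\<lambda>i. ?g (i + i)) (\<lambda>i j. ?g (i + j)))"
    unfolding n by (rule exactly_balanced_add_vertex[THEN balanced_if_exactly_balanced])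
  then show ?thesis by blast
qed

text \<open>Since 2 is invertible modulo 3, the diagonal of \<open>(i + j) mod 3\<close> is
  equidistributed as well; this leaves one construction for each residue of
  \<open>n\<close>.\<close>

lemma ex_balanced_three: "\<exists>p. balanced 3 n p"
proof -
  define k where "k = n div 3"
  let ?g = "\<lambda>x. x mod 3 :: nat"
  have g: "?g (x + 3) = ?g x" for x by simp
  have lessThan_3: "{..<3::nat} = {0, 1, 2}" by auto
  have three: "s = 0 \<or> s = 1 \<or> s = 2" if "s < 3" for s :: nat using that by linarith
  have one: "(\<Sum>l<3. of_bool (?g l = s)) = (1::nat)" if "s < 3" for s
    using three[OF that] by (auto simp: lessThan_3 simp del: sum_of_bool_eq)
  have p: "pair_coloring 3 (\<lambda>i j. ?g (i + j))"
    by (simp add: pair_coloring_def add.commute)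
  have rows: "equitable_rows (k * 1) 3 (3 * k) (\<lambda>i j. ?g (i + j))"
    using g one by (rule equitable_rows_Hankel)
  have "(\<Sum>j<3 * k. of_bool (?g (j + j) = s)) = k * 1" if "s < 3" for s :: nat
    using g by (rule sum_diagonal_Hankel)
      (use three that in \<open>auto simp: lessThan_3 simp del: sum_of_bool_eq\<close>)
  from exactly_balanced_add_vertex[OF p rows this]
  obtain q where q: "exactly_balanced (k * 1) 3 (Suc (3 * k)) q" by blast
  consider "n = 3 * k" | "n = Suc (3 * k)" | "n = Suc (Suc (3 * k))"
    unfolding k_def by linarith
  then show ?thesis
  proof cases
    case 1
    then show ?thesis using balanced_if_equitable_rows[OF p rows] by blast
  next
    case 2
    then show ?thesis using balanced_if_exactly_balanced[OF q] by blast
  next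
    case 3
    \<comment> \<open>The last vertex is joined to \<open>3 * k + 1\<close> others, so one color
      occurs there once more than \<open>k\<close> times.\<close>
    have "(\<Sum>j<3 * k. of_bool (?g j = s)) = k" if "s < 3" for s
      using sum_periodic[of "\<lambda>j. of_bool (?g j = s)" 3 k 0] one[OF that] by simp
    then have "balanced 3 (Suc (Suc (3 * k))) (add_vertex (Suc (3 * k)) ?g q)"
      using q by (intro balanced_add_vertex) auto
    then show ?thesis using 3 by blast
  qed
qed

section \<open>The parity obstruction\<close>

text \<open>The handshake identity for one color class, by double counting.\<close>

lemma (in finite_multigraph) sum_card_color_class:
  "(\<Sum>x\<in>verts G. card {e \<in> incident_edges G x. c e = s}) = 2 * card {e \<in> edges G. c e = s}"
proof -
  have "(\<Sum>x\<in>verts G. card {e \<in> {e \<in> edges G. c e = s}. x \<in> ends G e})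
      = 2 * card {e \<in> edges G. c e = s}"
  proof (rule sum_multicount[where k = 2])
    show "\<forall>e\<in>{e \<in> edges G. c e = s}. card {x \<in> verts G. x \<in> ends G e} = 2"
    proof
      fix e assume "e \<in> {e \<in> edges G. c e = s}"
      then have "{x \<in> verts G. x \<in> ends G e} = ends G e" "card (ends G e) = 2"
        using ends_verts card_ends by auto
      then show "card {x \<in> verts G. x \<in> ends G e} = 2" by simp
    qed
  qed (use finite_verts finite_edges in auto)
  moreover have "{e \<in> {e \<in> edges G. c e = s}. x \<in> ends G e} = {e \<in> incident_edges G x. c e = s}" for x
    by (auto simp: incident_edges_def)
  ultimately show ?thesis by simp
qed

lemma (in complete_multigraph) no_homogeneous_two:
  assumes "odd lam" "n mod 4 = 3"
  shows "\<not> homogeneous_edge_coloring 2 G S c"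
proof
  assume c: "homogeneous_edge_coloring 2 G S c"
  then have "finite S" "card S = 2" by (auto simp: homogeneous_edge_coloring_def)
  then obtain s where s: "s \<in> S" by fastforce
  define k where "k = n div 4"
  have n: "n = 4 * k + 3" using assms(2) unfolding k_def by presburger
  have "card {e \<in> incident_edges G x. c e = s} = lam * (2 * k + 1)" if x: "x \<in> verts G" for x
  proof -
    \<comment> \<open>The degree is even, so the remainder set is empty; its half is odd because
      \<open>lam\<close> is.\<close>
    have d: "card (incident_edges G x) = 2 * (lam * (2 * k + 1))"
      using card_incident_edges[OF x] by (simp add: n algebra_simps)
    obtain R where R: "R \<subseteq> S" "card R = card (incident_edges G x) mod 2"
      "\<forall>s\<in>S - R. card {e \<in> incident_edges G x. c e = s} = card (incident_edges G x) div 2"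
      using c x unfolding homogeneous_edge_coloring_def by meson
    then have "card R = 0" using d by simp
    then have "R = {}" using R(1) \<open>finite S\<close> by (simp add: finite_subset)
    then show ?thesis using R(3) s d by simp
  qed
  then have "n * (lam * (2 * k + 1)) = 2 * card {e \<in> edges G. c e = s}"
    using sum_card_color_class[of c s] by (simp add: card_verts)
  moreover have "odd (n * (lam * (2 * k + 1)))" using assms(1) n by simp
  ultimately show False by simp
qed

theorem theorem3p5:
  fixes lam n :: nat and G :: "('v, 'e) multigraph"
  assumes "1 \<le> lam" and "1 \<le> n" and "complete_multigraph lam n G"
  shows "homogeneous_chromatic_index G = (if odd lam \<and> n mod 4 = 3 then 3 else 2)"
proof -
  interpret complete_multigraph lam n G by fact
  show ?thesis
  proof (cases "odd lam \<and> n mod 4 = 3")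
    case True
    \<comment> \<open>Modulo 3 every residue is 0, 1 or \<open>m - 1\<close>, so three colors
      suffice for every \<open>lam\<close>.\<close>
    have "lam mod 3 \<in> {0, 1, 2}" by auto
    moreover obtain p where "balanced 3 n p" using ex_balanced_three by blast
    ultimately have "\<exists>c. homogeneous_edge_coloring 3 G {..<3::nat} c"
      by (intro ex_homogeneous_edge_coloring_if_balanced) (auto simp: balanced_def)
    moreover have "m \<noteq> 2" if "homogeneous_edge_coloring m G S c" for m and S :: "nat set" and c
      using that no_homogeneous_two True by blast
    ultimately have "homogeneous_chromatic_index G = 3"
      unfolding homogeneous_chromatic_index_def by (intro Least_equality) (auto, fastforce)
    then show ?thesis using True by simp
  next
    case False
    obtain p where "pair_coloring 2 p" "even lam \<or> balanced 2 n p"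
    proof (cases "even lam")
      case True
      \<comment> \<open>For even \<open>lam\<close> no edges are left over, so any pair coloring
        will do.\<close>
      then show thesis by (intro that[of "\<lambda>_ _. 0"]) (auto simp: pair_coloring_def)
    next
      case odd: False
      with False obtain p where "balanced 2 n p" using ex_balanced_two by blast
      then show thesis using that[of p] by (simp add: balanced_def)
    qed
    then have "\<exists>c. homogeneous_edge_coloring 2 G {..<2::nat} c"
      by (intro ex_homogeneous_edge_coloring_if_balanced)
        (auto simp: even_iff_mod_2_eq_zero odd_iff_mod_2_eq_one)
    then have "homogeneous_chromatic_index G = 2"
      unfolding homogeneous_chromatic_index_def by (intro Least_equality) auto
    then show ?thesis using False by simp
  qed
qed

end
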